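(* Let $f:\mathbb{C}\to\mathbb{C}$ be a transcendental entire function, let $D$ be an open disc meeting $J(f)$, and suppose that there exist Jordan curves $\gamma_n\subset\mathbb{C}$, $n\in\mathbb{N}$, such that, for all $n\in\mathbb{N}$, $\gamma_n$ surrounds $f^n(D)$ and $f(\gamma_n)$ surrounds the bounded component of $\mathbb{C}\setminus\gamma_{n+1}$. Then there exists a bounded domain $U$ with $\partial U\subset B_D(f)$ and $U\cap J(f)\neq\emptyset$. Thus $B_D(f)$, $B(f)$ and $I(f)$ are all connected.
   Context: $\mathbb{N}=\{1,2,3,\dots\}$ and $f^n$ denotes the $n$th iterate of $f$. The Fatou set $F(f)$ is the set of $z\in\mathbb{C}$ such that $(f^n)_{n\in\mathbb{N}}$ is a normal family in some neighbourhood of $z$; the Julia set is $J(f)=\mathbb{C}\setminus F(f)$. The escaping set is $I(f)=\{z\in\mathbb{C}: f^n(z)\to\infty \text{ as } n\to\infty\}$. A domain is a non-empty connected open set. For a bounded domain $G$, $\widetilde{G}$ denotes the union of $G$ and the bounded components of $\mathbb{C}\setminus G$. For an open disc $D$ meeting $J(f)$, $B_D(f)=\{z\in\mathbb{C}: f^n(z)\notin\widetilde{f^n(D)} \text{ for all } n\in\mathbb{N}\}$ and $B(f)=\{z\in\mathbb{C}: \text{there exists } L\in\mathbb{N} \text{ such that } f^{n+L}(z)\notin\widetilde{f^n(D)} \text{ for all } n\in\mathbb{N}\}$; the set $B(f)$ does not depend on the choice of the open disc $D$ meeting $J(f)$. A compact set $\gamma$ surrounds a connected set $S$ if $S$ lies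 in a bounded component of $\mathbb{C}\setminus\gamma$. *)

theory Defs
  imports "HOL-Complex_Analysis.Complex_Analysis"
begin

definition transcendental_entire :: "(complex \<Rightarrow> complex) \<Rightarrow> bool" where
  "transcendental_entire f \<longleftrightarrow> f holomorphic_on UNIV \<and> \<not> (\<exists>p. f = poly p)"

text \<open>Normality of a family of holomorphic functions on a domain \<open>U\<close>, in the extended sense:
  locally uniform convergence to \<open>\<infinity>\<close> is allowed, as with the spherical metric.\<close>

definition normal_family_on :: "complex set \<Rightarrow> (complex \<Rightarrow> complex) set \<Rightarrow> bool" where
  "normal_family_on U \<F> \<longleftrightarrow>
     (\<forall>h::nat \<Rightarrow> complex \<Rightarrow> complex. range h \<subseteq> \<F> \<longrightarrow>
       (\<exists>r::nat \<Rightarrow> nat. strict_mono r \<and>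
         ((\<exists>g. g holomorphic_on U \<and>
               (\<forall>K. compact K \<and> K \<subseteq> U \<longrightarrow> uniform_limit K (h \<circ> r) g sequentially)) \<or>
          (\<forall>K. compact K \<and> K \<subseteq> U \<longrightarrow>
               (\<forall>M. \<forall>\<^sub>F n in sequentially. \<forall>z\<in>K. M < norm (h (r n) z))))))"

definition Fatou_set :: "(complex \<Rightarrow> complex) \<Rightarrow> complex set" where
  "Fatou_set f =
     {z. \<exists>U. open U \<and> connected U \<and> z \<in> U \<and> normal_family_on U {f ^^ n |n. n \<ge> 1}}"

definition Julia_set :: "(complex \<Rightarrow> complex) \<Rightarrow> complex set" where
  "Julia_set f = - Fatou_set f"

definition escaping_set :: "(complex \<Rightarrow> complex) \<Rightarrow> complex set" where
  "escaping_set f = {z. filterlim (\<lambda>n. (f ^^ n) z) at_infinity sequentially}"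

text \<open>\<open>inside G\<close> is the union of the bounded components of \<open>- G\<close>.\<close>

definition filled :: "complex set \<Rightarrow> complex set" where
  "filled G = G \<union> inside G"

definition B_disc :: "(complex \<Rightarrow> complex) \<Rightarrow> complex set \<Rightarrow> complex set" where
  "B_disc f D = {z. \<forall>n\<ge>1. (f ^^ n) z \<notin> filled ((f ^^ n) ` D)}"

text \<open>For transcendental entire \<open>f\<close>, \<open>B_set f D\<close> is the same set for every open disc \<open>D\<close> meeting
  the Julia set of \<open>f\<close>.\<close>

definition B_set :: "(complex \<Rightarrow> complex) \<Rightarrow> complex set \<Rightarrow> complex set" where
  "B_set f D = {z. \<exists>L\<ge>1. \<forall>n\<ge>1. (f ^^ (n + L)) z \<notin> filled ((f ^^ n) ` D)}"

definition surrounds :: "complex set \<Rightarrow> complex set \<Rightarrow> bool" where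
  "surrounds \<gamma> S \<longleftrightarrow> (\<exists>C \<in> components (- \<gamma>). bounded C \<and> S \<subseteq> C)"

end

theory Submission
  imports Defs
begin

text \<open>Let \<open>D\<^sub>n = f\<^sup>n(D)\<close>. For \<open>N \<ge> 1\<close> the curves \<open>\<gamma>\<^sub>N, \<gamma>\<^sub>N\<^sub>+\<^sub>1, \<dots>\<close>, pulled back by the iterates of \<open>f\<close>,
  cut out a bounded domain \<open>U\<^sub>N \<supseteq> D\<^sub>N\<close> whose boundary orbits satisfy \<open>f\<^sup>k(z) \<notin> filled D\<^sub>N\<^sub>+\<^sub>k\<close> for all \<open>k\<close>.
  Since \<open>D\<close> meets the Julia set, Montel's and Picard's theorems show that \<open>filled D\<^sub>n\<close> eventually
  contains any given disc. So for large \<open>N\<close> the boundary of \<open>U\<^sub>N\<close> lies in \<open>B\<^sub>D(f)\<close>, and the connected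
  outer boundaries of the \<open>U\<^sub>N\<close> are loops in \<open>B\<^sub>D(f)\<close> surrounding any given disc.

  By the maximum principle, a compact set in the complement of the closed set \<open>B\<^sub>D(f)\<close> cannot
  surround a point of \<open>B\<^sub>D(f)\<close>. A separation of \<open>B\<^sub>D(f)\<close> would produce such a compact set inside one
  of the loops, so \<open>B\<^sub>D(f)\<close> is connected. The same holds for each of the sets \<open>f\<^sup>-\<^sup>L(B\<^sub>D(f))\<close>, whose
  union is \<open>B(f)\<close> and any two of which share a loop. Finally, the components of the complement
  of \<open>B(f)\<close> which contain an escaping point escape together with their closures, because the loops
  lie in \<open>B(f)\<close>; this attaches every escaping point to \<open>B(f) \<subseteq> I(f)\<close>.\<close>

section \<open>Filled sets\<close>

lemma filled_eq: "filled S = - outside S"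
  unfolding filled_def using inside_Un_outside[of S] inside_no_overlap[of S] inside_Int_outside[of S] outside_no_overlap[of S]
  by blast

lemma subset_filled: "S \<subseteq> filled S"
  by (auto simp: filled_def)

text \<open>A point of \<open>outside T\<close> is joined to infinity by a component of
  \<open>- T\<close> that lies in \<open>outside T\<close>, and \<open>S\<close> cannot meet that
  component.\<close>

lemma filled_subset_filled:
  assumes "S \<subseteq> filled T"
  shows "filled S \<subseteq> filled T"
proof -
  have "x \<in> outside S" if x: "x \<in> outside T" for x
  proof -
    let ?C = "connected_component_set (- T) x"
    have "?C \<subseteq> outside T"
      using outside_same_component[OF _ x] by blast
    then have "?C \<subseteq> - S"
      using assms by (auto simp: filled_eq)
    moreover have "x \<in> ?C"
      using x by (simp add: outside_def)
    ultimately have "?C \<subseteq> connected_component_set (- S) x"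
      by (intro connected_component_maximal) auto
    then show ?thesis
      using x by (simp add: outside) (meson bounded_subset)
  qed
  then show ?thesis
    by (auto simp: filled_eq)
qed

lemma filled_mono: "S \<subseteq> T \<Longrightarrow> filled S \<subseteq> filled T"
  using filled_subset_filled subset_filled by blast

lemma bounded_filled:
  fixes S :: "complex set"
  shows "bounded S \<Longrightarrow> bounded (filled S)"
  by (simp add: filled_def bounded_inside)

lemma connected_disjoint_filled:
  assumes "connected C" "\<not> bounded C" "C \<inter> S = {}"
  shows "C \<inter> filled S = {}"
proof -
  have "x \<in> outside S" if "x \<in> C" for x
  proof -
    have "C \<subseteq> connected_component_set (- S) x"
      using assms that by (intro connected_component_maximal) auto
    then show ?thesis
      using assms(2) by (auto simp: outside dest: bounded_subset)
  qed
  then show ?thesis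
    by (auto simp: filled_eq)
qed

lemma ball_subset_filled:
  fixes S :: "complex set"
  assumes "sphere a R \<subseteq> S"
  shows "ball a R \<subseteq> filled S"
proof
  fix x assume x: "x \<in> ball a R"
  then have R: "0 < R"
    by (metis empty_iff ball_eq_empty not_le)
  let ?C = "connected_component_set (- S) x"
  have "bounded ?C" if "x \<notin> S"
  proof -
    have "?C \<subseteq> ball a R"
    proof (rule ccontr)
      assume "\<not> ?C \<subseteq> ball a R"
      moreover have "x \<in> ?C \<inter> ball a R"
        using x that by auto
      ultimately have "?C \<inter> frontier (ball a R) \<noteq> {}"
        by (intro connected_Int_frontier) blast+
      moreover have "?C \<subseteq> - S"
        by (rule connected_component_subset)
      moreover have "frontier (ball a R) \<subseteq> S"
        using assms R frontier_ball[of R a] by simp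
      ultimately show False
        by blast
    qed
    then show ?thesis
      by (meson bounded_ball bounded_subset)
  qed
  then show "x \<in> filled S"
    by (auto simp: filled_def inside_def)
qed

text \<open>\<open>K\<close> is the level set of the distance to \<open>A\<close> at half the gap
  \<open>d\<close> between \<open>A\<close> and \<open>B\<close>. By the intermediate value theorem
  the component of \<open>- K\<close> through \<open>x\<close> stays where that distance is at most
  \<open>d/2\<close>, a bounded region.\<close>

lemma compact_separated:
  fixes A B :: "complex set"
  assumes "compact A" "closed B" "A \<inter> B = {}" "x \<in> A"
  obtains K where "compact K" "K \<inter> A = {}" "K \<inter> B = {}" "x \<in> inside K"
proof -
  obtain d where d: "d > 0" "\<And>u v. u \<in> A \<Longrightarrow> v \<in> B \<Longrightarrow> d \<le> dist u v"
    using separate_compact_closed[OF assms(1-3)] by blast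
  have A: "A \<noteq> {}" "closed A" "bounded A"
    using assms by (auto simp: compact_imp_closed compact_imp_bounded)
  let ?g = "\<lambda>z. infdist z A"
  have cont: "continuous_on X ?g" for X
    by (intro continuous_on_infdist continuous_on_id)
  have bd: "bounded {z. ?g z \<le> d/2}"
  proof -
    obtain M where M: "\<And>a. a \<in> A \<Longrightarrow> norm a \<le> M"
      using A(3) by (auto simp: bounded_iff)
    have "norm z \<le> M + d" if "?g z \<le> d/2" for z
    proof -
      obtain a where "a \<in> A" "?g z = dist z a"
        using infdist_attains_inf[OF A(2,1)] by blast
      then have "norm z \<le> norm a + d"
        using that d(1) norm_triangle_sub[of z a] by (simp add: dist_norm)
      then show ?thesis
        using M[OF \<open>a \<in> A\<close>] by linarith
    qed
    then show ?thesis
      by (auto simp: bounded_iff)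
  qed
  define K where "K = {z. ?g z = d/2}"
  have "closed K"
    unfolding K_def by (intro closed_Collect_eq cont continuous_on_const)
  moreover have "bounded K"
    using bd by (rule bounded_subset) (auto simp: K_def)
  ultimately have "compact K"
    by (simp add: compact_eq_bounded_closed)
  moreover have KA: "K \<inter> A = {}"
    using d(1) by (auto simp: K_def)
  moreover have "K \<inter> B = {}"
  proof -
    have "d \<le> ?g v" if "v \<in> B" for v
      using infdist_attains_inf[OF A(2,1), of v] d(2)[OF _ that] by (metis dist_commute)
    then show ?thesis
      using d(1) by (fastforce simp: K_def)
  qed
  moreover have "x \<in> inside K"
  proof -
    let ?C = "connected_component_set (- K) x"
    have x: "x \<in> ?C" "?g x = 0"
      using assms(4) KA by auto
    have "?g z \<le> d/2" if z: "z \<in> ?C" for z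
    proof (rule ccontr)
      assume "\<not> ?thesis"
      moreover have "connected (?g ` ?C)"
        by (intro connected_continuous_image cont) simp
      moreover have "0 \<in> ?g ` ?C" "?g z \<in> ?g ` ?C"
        using x z by (force, blast)
      ultimately have "d/2 \<in> ?g ` ?C"
        using d(1) connectedD_interval[of "?g ` ?C" 0 "?g z" "d/2"] by simp
      moreover have "?C \<subseteq> - K"
        by (rule connected_component_subset)
      ultimately show False
        by (force simp: K_def)
    qed
    then have "bounded ?C"
      by (intro bounded_subset[OF bd]) auto
    then show ?thesis
      using assms(4) KA by (auto simp: inside_def)
  qed
  ultimately show ?thesis
    by (rule that)
qed

text \<open>A bounded component of \<open>- S\<close> is compact, so Sura-Bura encloses it in a
  compact relatively clopen part \<open>A\<close> of \<open>- S\<close>. A compact set separating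
  \<open>A\<close> from the rest of \<open>- S\<close> lies in \<open>S\<close>.\<close>

lemma filled_open_compact_subset:
  fixes S :: "complex set"
  assumes "open S" "x \<in> filled S"
  obtains K where "compact K" "K \<subseteq> S" "x \<in> filled K" "x \<in> S \<or> x \<in> inside K"
proof (cases "x \<in> S")
  case True
  then show ?thesis
    using that[of "{x}"] subset_filled[of "{x}"] by simp
next
  case False
  let ?C = "connected_component_set (- S) x"
  have x: "x \<in> ?C" "bounded ?C"
    using assms False by (auto simp: filled_def inside_def)
  have "closed ?C"
    using assms(1) by (intro closed_connected_component) auto
  then have cC: "compact ?C"
    using x by (simp add: compact_eq_bounded_closed)
  have "?C \<in> components (- S)"
    using False by (auto simp: components_def)
  moreover have "locally compact (- S)"
    using assms(1) by (intro closed_imp_locally_compact) auto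
  ultimately obtain A where A: "openin (top_of_set (- S)) A" "compact A" "?C \<subseteq> A"
    using Sura_Bura_clopen_subset[of "- S" ?C UNIV, OF _ _ cC open_UNIV subset_UNIV] by metis
  obtain T where T: "open T" "A = - S \<inter> T"
    using A(1) by (auto simp: openin_open)
  have "closed (- S - T)"
    using assms(1) T(1) by (intro closed_Diff) auto
  moreover have "A \<inter> (- S - T) = {}"
    using T by auto
  ultimately obtain K where "compact K" "K \<inter> A = {}" "K \<inter> (- S - T) = {}" "x \<in> inside K"
    using compact_separated[OF A(2), of "- S - T" x] x(1) A(3) by (metis subsetD)
  then show ?thesis
    using that[of K] T by (auto simp: filled_def)
qed

lemma open_filled:
  fixes S :: "complex set"
  assumes "open S"
  shows "open (filled S)"
proof (subst open_subopen, intro ballI)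
  fix x assume "x \<in> filled S"
  then obtain K where K: "compact K" "K \<subseteq> S" "x \<in> S \<or> x \<in> inside K"
    using filled_open_compact_subset[OF assms] by metis
  have "open (inside K)" "inside K \<subseteq> filled S"
    using K filled_mono[OF K(2)] by (auto simp: open_inside compact_imp_closed filled_def)
  then show "\<exists>T. open T \<and> x \<in> T \<and> T \<subseteq> filled S"
    using K(3) assms subset_filled by blast
qed

text \<open>Both versions of the maximum principle rest on \<open>\<partial>g(V) \<subseteq> g(\<partial>V)\<close> for bounded open \<open>V\<close>.\<close>

lemma image_filled_subset_compact:
  assumes g: "g holomorphic_on UNIV" and K: "compact K"
  shows "g ` filled K \<subseteq> filled (g ` K)"
proof
  fix y assume "y \<in> g ` filled K"
  then obtain x where x: "x \<in> filled K" "y = g x" by blast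
  show "y \<in> filled (g ` K)"
  \<comment> \<open>A constant \<open>g\<close> is set aside because the open mapping theorem fails
    for it.\<close>
  proof (cases "x \<in> K \<or> g constant_on UNIV")
    case True
    have "K \<noteq> {}"
      using x by (auto simp: filled_eq)
    then have "y \<in> g ` K"
      using True x by (fastforce simp: constant_on_def)
    then show ?thesis
      using subset_filled[of "g ` K"] by (rule subsetD[rotated])
  next
    case False
    let ?V = "connected_component_set (- K) x"
    let ?C = "connected_component_set (- g ` K) y"
    have V: "open ?V" "bounded ?V" "x \<in> ?V"
      using x False K by (auto simp: filled_def inside_def compact_imp_closed open_connected_component open_Compl)
    have fr: "frontier ?V \<subseteq> K"
    proof -
      have "?V \<in> components (- K)"
        using False by (auto simp: components_def)
      then show ?thesis
        using frontier_of_components_closed_complement[of K ?V] K compact_imp_closed by blast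
    qed
    have cont: "continuous_on X g" for X
      using g holomorphic_on_imp_continuous_on holomorphic_on_subset by blast
    have open_gV: "open (g ` ?V)"
      using open_mapping_thm[OF g open_UNIV connected_UNIV V(1)] False by auto
    have cpt: "compact (g ` closure ?V)"
      using V(2) by (intro compact_continuous_image cont) (simp add: compact_closure)
    have "frontier (g ` ?V) \<subseteq> g ` K"
    proof
      fix w assume w: "w \<in> frontier (g ` ?V)"
      then have "w \<in> closure (g ` ?V)" "w \<notin> g ` ?V"
        using open_gV by (auto simp: frontier_def interior_open)
      moreover have "closure (g ` ?V) \<subseteq> g ` closure ?V"
        using cpt by (intro closure_minimal image_mono closure_subset compact_imp_closed)
      ultimately obtain v where "v \<in> closure ?V" "w = g v" "v \<notin> ?V" by blast
      then show "w \<in> g ` K"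
        using fr V(1) by (auto simp: frontier_def interior_open)
    qed
    then have no: "?C \<inter> frontier (g ` ?V) = {}"
      using connected_component_subset[of "- g ` K" y] by blast
    have "bounded ?C" if "y \<notin> g ` K"
    proof -
      have "?C \<subseteq> g ` ?V"
      proof (rule ccontr)
        assume "\<not> ?thesis"
        moreover have "y \<in> ?C \<inter> g ` ?V"
          using that V(3) x(2) by auto
        ultimately have "?C \<inter> frontier (g ` ?V) \<noteq> {}"
          by (intro connected_Int_frontier) blast+
        then show False using no by blast
      qed
      moreover have "bounded (g ` ?V)"
        using cpt by (meson bounded_subset closure_subset compact_imp_bounded image_mono)
      ultimately show ?thesis
        using bounded_subset by blast
    qed
    then show ?thesis
      by (auto simp: filled_def inside_def)
  qed
qed

lemma image_filled_subset_open:
  assumes g: "g holomorphic_on UNIV" and S: "open S"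
  shows "g ` filled S \<subseteq> filled (g ` S)"
proof
  fix y assume "y \<in> g ` filled S"
  then obtain x where x: "x \<in> filled S" "y = g x" by blast
  obtain K where K: "compact K" "K \<subseteq> S" "x \<in> filled K"
    using filled_open_compact_subset[OF S x(1)] by metis
  then have "y \<in> filled (g ` K)"
    using image_filled_subset_compact[OF g K(1)] x(2) by blast
  then show "y \<in> filled (g ` S)"
    using filled_mono[OF image_mono[OF K(2)]] by blast
qed

text \<open>The complement of \<open>filled S\<close> is the unbounded component of
  \<open>- S\<close>, and in the plane each complementary component of a connected set has connected
  frontier. These frontiers will be the loops.\<close>

lemma connected_frontier_filled:
  fixes S :: "complex set"
  assumes "connected S" "bounded S"
  shows "connected (frontier (filled S))"
proof -
  have "outside S \<noteq> {}"
    using unbounded_outside[OF assms(2)] by auto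
  then have "outside S \<in> components (- S)"
    using connected_outside[OF assms(2)] by (simp add: outside_in_components)
  then show ?thesis
    using connected_frontier_component_complement[OF assms(1)]
    by (simp add: filled_eq frontier_complement)
qed

text \<open>A ball missing \<open>S\<close> lies in one component of \<open>- S\<close>; around a
  point outside \<open>filled S\<close> it therefore misses \<open>filled S\<close> as well.\<close>

lemma frontier_filled_subset:
  fixes S :: "complex set"
  assumes "open S"
  shows "frontier (filled S) \<subseteq> frontier S"
proof
  fix x assume "x \<in> frontier (filled S)"
  then have x: "x \<in> closure (filled S)" "x \<notin> filled S"
    using open_filled[OF assms] by (auto simp: frontier_def interior_open)
  have "x \<in> closure S"
  proof (rule ccontr)
    assume "x \<notin> closure S"
    then have "x \<in> - closure S" "open (- closure S)"
      by auto
    then obtain e where "e > 0" "ball x e \<subseteq> - closure S"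
      by (meson open_contains_ball)
    then have e: "e > 0" "ball x e \<inter> S = {}"
      using closure_subset by blast+
    have "ball x e \<subseteq> outside S"
    proof
      fix y assume "y \<in> ball x e"
      moreover have "ball x e \<subseteq> connected_component_set (- S) x"
        using e by (intro connected_component_maximal) auto
      ultimately show "y \<in> outside S"
        using x(2) outside_same_component[of S x y] by (auto simp: filled_eq)
    qed
    then have "ball x e \<inter> filled S = {}"
      by (auto simp: filled_eq)
    then show False
      using x(1) e(1) open_Int_closure_eq_empty[of "ball x e" "filled S"] centre_in_ball[of x e] by blast
  qed
  then show "x \<in> frontier S"
    using x(2) assms subset_filled by (auto simp: frontier_def interior_open)
qed

section \<open>Normal families\<close>

lemma holomorphic_on_funpow:
  assumes "f holomorphic_on UNIV"
  shows "(f ^^ n) holomorphic_on UNIV"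
proof (induction n)
  case (Suc n)
  then show ?case
    using holomorphic_on_compose_gen[OF Suc.IH assms] by (simp add: o_def)
qed (simp add: id_def)

text \<open>The condition that \<open>normal_family_on\<close> puts on a single sequence, isolated
  so that it can be passed along subsequences and compositions.\<close>

definition spherically_subconvergent :: "complex set \<Rightarrow> (nat \<Rightarrow> complex \<Rightarrow> complex) \<Rightarrow> bool" where
  "spherically_subconvergent U h \<longleftrightarrow>
     (\<exists>r::nat \<Rightarrow> nat. strict_mono r \<and>
         ((\<exists>g. g holomorphic_on U \<and>
               (\<forall>K. compact K \<and> K \<subseteq> U \<longrightarrow> uniform_limit K (h \<circ> r) g sequentially)) \<or>
          (\<forall>K. compact K \<and> K \<subseteq> U \<longrightarrow>
               (\<forall>M. \<forall>\<^sub>F n in sequentially. \<forall>z\<in>K. M < norm (h (r n) z)))))"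

lemma normal_family_on_iff:
  "normal_family_on U \<F> \<longleftrightarrow> (\<forall>h. range h \<subseteq> \<F> \<longrightarrow> spherically_subconvergent U h)"
  by (simp add: normal_family_on_def spherically_subconvergent_def)

lemma spherically_subconvergent_subseq:
  assumes "strict_mono s" "spherically_subconvergent U (h \<circ> s)"
  shows "spherically_subconvergent U h"
proof -
  obtain r where r: "strict_mono (r :: nat \<Rightarrow> nat)"
      "(\<exists>g. g holomorphic_on U \<and>
               (\<forall>K. compact K \<and> K \<subseteq> U \<longrightarrow> uniform_limit K ((h \<circ> s) \<circ> r) g sequentially)) \<or>
          (\<forall>K. compact K \<and> K \<subseteq> U \<longrightarrow>
               (\<forall>M. \<forall>\<^sub>F n in sequentially. \<forall>z\<in>K. M < norm ((h \<circ> s) (r n) z)))"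
    using assms(2) unfolding spherically_subconvergent_def by blast
  show ?thesis
    unfolding spherically_subconvergent_def
    using strict_mono_o[OF assms(1) r(1)] r(2) by (intro exI[of _ "s \<circ> r"]) (simp add: o_assoc)
qed

lemma spherically_subconvergent_compose:
  assumes f: "f holomorphic_on V" "f ` V \<subseteq> U" and h: "spherically_subconvergent U h"
  shows "spherically_subconvergent V (\<lambda>n. h n \<circ> f)"
proof -
  obtain r where r: "strict_mono (r :: nat \<Rightarrow> nat)"
      "(\<exists>g. g holomorphic_on U \<and>
               (\<forall>K. compact K \<and> K \<subseteq> U \<longrightarrow> uniform_limit K (h \<circ> r) g sequentially)) \<or>
          (\<forall>K. compact K \<and> K \<subseteq> U \<longrightarrow>
               (\<forall>M. \<forall>\<^sub>F n in sequentially. \<forall>z\<in>K. M < norm (h (r n) z)))"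
    using h unfolding spherically_subconvergent_def by blast
  have fK: "compact (f ` K)" "f ` K \<subseteq> U" if "compact K" "K \<subseteq> V" for K
  proof -
    have "continuous_on K f"
      using f(1) that(2) by (meson continuous_on_subset holomorphic_on_imp_continuous_on)
    then show "compact (f ` K)"
      using that(1) by (intro compact_continuous_image)
  qed (use f(2) that in blast)
  show ?thesis
    unfolding spherically_subconvergent_def
  proof (intro exI conjI, rule r(1))
    show "(\<exists>g. g holomorphic_on V \<and> (\<forall>K. compact K \<and> K \<subseteq> V \<longrightarrow>
              uniform_limit K ((\<lambda>n. h n \<circ> f) \<circ> r) g sequentially)) \<or>
          (\<forall>K. compact K \<and> K \<subseteq> V \<longrightarrow>
              (\<forall>M. \<forall>\<^sub>F n in sequentially. \<forall>z\<in>K. M < norm ((h (r n) \<circ> f) z)))"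
      using r(2)
    proof (elim disjE exE conjE)
      fix g assume g: "g holomorphic_on U"
        "\<forall>K. compact K \<and> K \<subseteq> U \<longrightarrow> uniform_limit K (h \<circ> r) g sequentially"
      have "g \<circ> f holomorphic_on V"
        using f(1) g(1) f(2) by (rule holomorphic_on_compose_gen)
      moreover have "uniform_limit K ((\<lambda>n. h n \<circ> f) \<circ> r) (g \<circ> f) sequentially"
        if "compact K" "K \<subseteq> V" for K
        using uniform_limit_compose'[OF g(2)[rule_format, OF conjI[OF fK[OF that]]], of f K]
        by (auto simp: o_def)
      ultimately show ?thesis by blast
    next
      assume inf: "\<forall>K. compact K \<and> K \<subseteq> U \<longrightarrow>
               (\<forall>M. \<forall>\<^sub>F n in sequentially. \<forall>z\<in>K. M < norm (h (r n) z))"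
      have "\<forall>\<^sub>F n in sequentially. \<forall>z\<in>K. M < norm ((h (r n) \<circ> f) z)"
        if "compact K" "K \<subseteq> V" for K M
        using inf[rule_format, OF conjI[OF fK[OF that]], of M] by simp
      then show ?thesis by blast
    qed
  qed
qed

text \<open>Either all but finitely many exponents are at least \<open>n0\<close>, or one smaller
  exponent recurs infinitely often and gives a constant subsequence.\<close>

lemma normal_family_on_iterates:
  assumes f: "f holomorphic_on UNIV"
    and tail: "\<And>m. (\<And>i. n0 \<le> m i) \<Longrightarrow> spherically_subconvergent U (\<lambda>i. f ^^ m i)"
  shows "normal_family_on U {f ^^ n |n. n \<ge> 1}"
  unfolding normal_family_on_iff
proof (intro allI impI)
  fix h :: "nat \<Rightarrow> complex \<Rightarrow> complex" assume "range h \<subseteq> {f ^^ n |n. n \<ge> 1}"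
  then have "\<forall>i. \<exists>n. h i = f ^^ n"
    by blast
  then obtain m where m: "\<And>i. h i = f ^^ m i"
    by metis
  show "spherically_subconvergent U h"
  proof (cases "finite {i. m i < n0}")
    case True
    then obtain i0 where i0: "\<forall>i\<in>{i. m i < n0}. i < i0"
      unfolding finite_nat_set_iff_bounded by blast
    have "n0 \<le> m (i + i0)" for i
      using i0[rule_format, of "i + i0"] by (cases "m (i + i0) < n0") auto
    then have "spherically_subconvergent U (\<lambda>i. f ^^ m (i + i0))"
      by (rule tail)
    moreover have "h \<circ> (\<lambda>i. i + i0) = (\<lambda>i. f ^^ m (i + i0))"
      by (rule ext) (simp only: o_def m)
    moreover have "strict_mono (\<lambda>i. i + i0)"
      by (simp add: strict_mono_def)
    ultimately show ?thesis
      using spherically_subconvergent_subseq by metis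
  next
    case False
    moreover have "finite (m ` {i. m i < n0})"
      by (rule finite_subset[of _ "{..<n0}"]) auto
    ultimately obtain j where "infinite {i \<in> {i. m i < n0}. m i = m j}"
      using pigeonhole_infinite[of "{i. m i < n0}" m] by blast
    then obtain r :: "nat \<Rightarrow> nat" where r: "strict_mono r" "\<And>n. m (r n) = m j"
      using infinite_enumerate by blast
    have "f ^^ m j holomorphic_on U"
      using holomorphic_on_subset[OF holomorphic_on_funpow[OF f]] by auto
    then show ?thesis
      unfolding spherically_subconvergent_def
      using r by (intro exI[of _ r] conjI disjI1 exI[of _ "f ^^ m j"])
                 (auto simp: o_def m uniform_limit_const)
  qed
qed

text \<open>Contrapositively, normality near \<open>f z\<close> is pulled back by composition with
  \<open>f\<close> to a ball around \<open>z\<close>.\<close>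

lemma Julia_set_funpow:
  assumes f: "f holomorphic_on UNIV" and z: "z \<in> Julia_set f"
  shows "(f ^^ n) z \<in> Julia_set f"
proof (induction n)
  case (Suc n)
  have "z \<in> Fatou_set f" if fz: "f z \<in> Fatou_set f" for z
  proof -
    obtain U where U: "open U" "f z \<in> U" "normal_family_on U {f ^^ n |n. n \<ge> 1}"
      using fz by (auto simp: Fatou_set_def)
    have "open (f -` U)"
      using U(1) f by (intro open_vimage holomorphic_on_imp_continuous_on)
    then obtain e where e: "e > 0" "ball z e \<subseteq> f -` U"
      using U(2) open_contains_ball by (metis vimageI2)
    have "normal_family_on (ball z e) {f ^^ n |n. n \<ge> 1}"
    \<comment> \<open>Exponents from 2 on keep \<open>m i - 1\<close> at least 1, where normality
      near \<open>f z\<close> applies.\<close>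
    proof (rule normal_family_on_iterates[OF f, of 2])
      fix m :: "nat \<Rightarrow> nat" assume m: "\<And>i. 2 \<le> m i"
      have "range (\<lambda>i. f ^^ (m i - 1)) \<subseteq> {f ^^ n |n. n \<ge> 1}"
      proof clarify
        fix i
        have "1 \<le> m i - 1"
          using m[of i] by linarith
        then show "\<exists>n. f ^^ (m i - 1) = f ^^ n \<and> 1 \<le> n"
          by blast
      qed
      then have "spherically_subconvergent U (\<lambda>i. f ^^ (m i - 1))"
        using U(3) by (simp add: normal_family_on_iff)
      then have "spherically_subconvergent (ball z e) (\<lambda>i. f ^^ (m i - 1) \<circ> f)"
        using e(2) by (intro spherically_subconvergent_compose holomorphic_on_subset[OF f]) auto
      moreover have "f ^^ (m i - 1) \<circ> f = f ^^ m i" for i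
        using m[of i] funpow_Suc_right[of "m i - 1" f] by simp
      ultimately show "spherically_subconvergent (ball z e) (\<lambda>i. f ^^ m i)"
        by simp
    qed
    then show ?thesis
      using e(1) unfolding Fatou_set_def by (auto intro!: exI[of _ "ball z e"])
  qed
  then show ?case
    using Suc.IH by (auto simp: Julia_set_def)
qed (use z in simp)

text \<open>The hypotheses on \<open>a\<close>, \<open>b\<close> make the affine maps taking \<open>a i, b i\<close> to \<open>0, 1\<close> uniformly
  bi-Lipschitz, which reduces to functions omitting 0 and 1.\<close>

lemma spherically_subconvergent_omitting:
  fixes a b :: "nat \<Rightarrow> complex"
  assumes S: "open S" "connected S"
    and hol: "\<And>i. F i holomorphic_on S"
    and a: "\<And>i. norm (a i) \<le> M" and b: "\<And>i. norm (b i) \<le> M"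
    and \<delta>: "\<delta> > 0" "\<And>i. \<delta> \<le> norm (b i - a i)"
    and omit: "\<And>i z. z \<in> S \<Longrightarrow> F i z \<noteq> a i \<and> F i z \<noteq> b i"
  shows "spherically_subconvergent S F"
proof (cases "S = {}")
  case True
  then show ?thesis
    unfolding spherically_subconvergent_def
    by (intro exI[of _ id] conjI disjI2) (auto simp: strict_mono_def)
next
  case False
  then obtain w where w: "w \<in> S" by blast
  have M0: "M \<ge> 0"
    using a[of 0] norm_ge_zero order_trans by blast
  have ab: "b i \<noteq> a i" for i
    using \<delta>(1) \<delta>(2)[of i] by auto
  define k where "k = (\<lambda>i z. (F i z - a i) / (b i - a i))"
  have holk: "k i holomorphic_on S" for i
    unfolding k_def using ab[of i] by (intro holomorphic_intros hol) auto
  have k01: "k i z \<noteq> 0 \<and> k i z \<noteq> 1" if "z \<in> S" for i z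
    using omit[OF that, of i] ab[of i] by (auto simp: k_def field_simps)
  have F_eq: "F i z = a i + (b i - a i) * k i z" for i z
    using ab[of i] by (simp add: k_def)
  have F_le: "norm (F i z) \<le> M + 2 * M * B" if "norm (k i z) \<le> B" for i z B
  proof -
    have "norm (F i z) \<le> norm (a i) + norm (b i - a i) * norm (k i z)"
      unfolding F_eq[of i z] using norm_triangle_ineq by (metis norm_mult)
    also have "\<dots> \<le> M + (2 * M) * B"
      using a[of i] b[of i] norm_triangle_ineq4[of "b i" "a i"] that M0
      by (intro add_mono mult_mono) auto
    finally show ?thesis by simp
  qed
  have F_ge: "norm (F i z) \<ge> \<delta> * norm (k i z) - M" for i z
  proof -
    have "\<delta> * norm (k i z) \<le> norm (b i - a i) * norm (k i z)"
      using \<delta>(2) by (intro mult_right_mono) auto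
    also have "\<dots> = norm (F i z - a i)"
      using ab[of i] by (simp add: k_def norm_divide)
    also have "\<dots> \<le> norm (F i z) + M"
      using norm_triangle_ineq4[of "F i z" "a i"] a[of i] by linarith
    finally show ?thesis by simp
  qed
  have bdd: "spherically_subconvergent S F"
    if r: "strict_mono r" and B: "\<And>K. compact K \<Longrightarrow> K \<subseteq> S \<Longrightarrow> \<exists>B. \<forall>i. \<forall>z\<in>K. norm (k (r i) z) \<le> B"
    for r :: "nat \<Rightarrow> nat"
  proof (rule spherically_subconvergent_subseq[OF r])
    obtain g s where "g holomorphic_on S" "strict_mono (s :: nat \<Rightarrow> nat)"
      "\<And>K. \<lbrakk>compact K; K \<subseteq> S\<rbrakk> \<Longrightarrow> uniform_limit K ((F \<circ> r) \<circ> s) g sequentially"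
    proof (rule Montel[of S "range (F \<circ> r)" "F \<circ> r"])
      show "\<exists>B. \<forall>h\<in>range (F \<circ> r). \<forall>z\<in>K. norm (h z) \<le> B" if "compact K" "K \<subseteq> S" for K
        using B[OF that] F_le by fastforce
    qed (use S hol in auto)
    then show "spherically_subconvergent S (F \<circ> r)"
      unfolding spherically_subconvergent_def by blast
  qed
  show ?thesis
  \<comment> \<open>At the base point \<open>w\<close> either infinitely many \<open>k i\<close> or
    infinitely many reciprocals are at most 1 in modulus. The reciprocals also omit 0 and 1, so the
    local bound \<open>GPicard3\<close> serves both cases.\<close>
  proof (cases "infinite {i. norm (k i w) \<le> 1}")
    case True
    then obtain r :: "nat \<Rightarrow> nat" where r: "strict_mono r" "\<And>n. norm (k (r n) w) \<le> 1"
      using infinite_enumerate by blast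
    show ?thesis
    proof (rule bdd[OF r(1)])
      fix K assume K: "compact K" "K \<subseteq> S"
      show "\<exists>B. \<forall>i. \<forall>z\<in>K. norm (k (r i) z) \<le> B"
      proof -
        obtain B where "\<And>h z. \<lbrakk>h \<in> range (\<lambda>i. k (r i)); z \<in> K\<rbrakk> \<Longrightarrow> norm (h z) \<le> B"
          by (rule GPicard3[of S w "range (\<lambda>i. k (r i))" "range (\<lambda>i. k (r i))" K])
             (use S w holk k01 r K in auto)
        then show ?thesis by blast
      qed
    qed
  next
    case False
    then have "infinite (- {i. norm (k i w) \<le> 1})"
      using finite_compl[of "{i. norm (k i w) \<le> 1}"] by simp
    then obtain r :: "nat \<Rightarrow> nat" where r: "strict_mono r"
        "\<forall>n. r n \<in> - {i. norm (k i w) \<le> 1}"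
      using infinite_enumerate by metis
    have rw: "norm (k (r n) w) > 1" for n
      using r(2)[rule_format, of n] by simp
    define j where "j = (\<lambda>i z. inverse (k (r i) z))"
    have holj: "j i holomorphic_on S" for i
      unfolding j_def using k01 by (intro holomorphic_intros holk) auto
    have j01: "j i z \<noteq> 0 \<and> j i z \<noteq> 1" if "z \<in> S" for i z
      using k01[OF that] by (auto simp: j_def)
    have jw: "norm (j i w) \<le> 1" for i
      using rw[of i] by (simp add: j_def norm_inverse inverse_le_1_iff)
    have jbd: "\<exists>B. \<forall>h\<in>range j. \<forall>z\<in>K. norm (h z) \<le> B" if K: "compact K" "K \<subseteq> S" for K
    proof -
      obtain B where "\<And>h z. \<lbrakk>h \<in> range j; z \<in> K\<rbrakk> \<Longrightarrow> norm (h z) \<le> B"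
        by (rule GPicard3[of S w "range j" "range j" K]) (use S w holj j01 jw K in auto)
      then show ?thesis by blast
    qed
    obtain g s where g: "g holomorphic_on S" and s: "strict_mono (s :: nat \<Rightarrow> nat)"
      and ul: "\<And>K. \<lbrakk>compact K; K \<subseteq> S\<rbrakk> \<Longrightarrow> uniform_limit K (j \<circ> s) g sequentially"
      by (rule Montel[of S "range j" j]) (use S holj jbd in auto)
    have rs: "strict_mono (r \<circ> s)"
      using r(1) s by (rule strict_mono_o)
    show ?thesis
    \<comment> \<open>By Hurwitz the limit \<open>g\<close> of the reciprocals vanishes identically
      or nowhere. In the first case \<open>F\<close> tends to infinity along the subsequence; in the
      second the \<open>k\<close> are bounded on compact sets along it.\<close>
    proof (cases "\<forall>z\<in>S. g z = 0")
      case True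
      have "\<forall>\<^sub>F n in sequentially. \<forall>z\<in>K. C < norm (F ((r \<circ> s) n) z)"
        if K: "compact K" "K \<subseteq> S" for K C
      proof -
        \<comment> \<open>With this choice a reciprocal of modulus below \<epsilon> makes the lower
          bound \<open>F_ge\<close> exceed \<open>C\<close>.\<close>
        define \<epsilon> where "\<epsilon> = \<delta> / (M + \<bar>C\<bar> + 1)"
        have \<epsilon>: "\<epsilon> > 0"
          using \<delta>(1) M0 by (simp add: \<epsilon>_def)
        have "\<forall>\<^sub>F n in sequentially. \<forall>z\<in>K. dist ((j \<circ> s) n z) (g z) < \<epsilon>"
          using uniform_limitD[OF ul[OF K] \<epsilon>] .
        then show ?thesis
        proof eventually_elim
          case (elim n)
          show ?case
          proof
            fix z assume z: "z \<in> K"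
            let ?i = "(r \<circ> s) n"
            have "g z = 0"
              using True z K(2) by blast
            then have "norm (inverse (k ?i z)) < \<epsilon>"
              using elim[rule_format, OF z] by (simp add: j_def)
            moreover have "norm (k ?i z) > 0"
              using k01 z K(2) by auto
            ultimately have "1 < \<epsilon> * norm (k ?i z)"
              unfolding norm_inverse by (simp add: field_simps del: norm_inverse)
            then have "M + \<bar>C\<bar> + 1 < \<delta> * norm (k ?i z)"
              using M0 by (simp add: \<epsilon>_def field_simps)
            then show "C < norm (F ?i z)"
              using F_ge[of ?i z] by linarith
          qed
        qed
      qed
      then show ?thesis
        unfolding spherically_subconvergent_def using rs by blast
    next
      case False
      have nz: "g z \<noteq> 0" if z: "z \<in> S" for z
      proof (cases "g constant_on S")
        case True
        then show ?thesis
          using False z by (auto simp: constant_on_def)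
      next
        case nonconst: False
        show ?thesis
          by (rule Hurwitz_no_zeros[OF S _ g ul nonconst _ z]) (use holj j01 in auto)
      qed
      show ?thesis
      proof (rule bdd[OF rs])
        fix K assume K: "compact K" "K \<subseteq> S"
        show "\<exists>B. \<forall>i. \<forall>z\<in>K. norm (k ((r \<circ> s) i) z) \<le> B"
        proof (cases "K = {}")
          case False
          have "continuous_on K (\<lambda>z. norm (g z))"
            using K(2) g by (intro continuous_intros) (meson continuous_on_subset holomorphic_on_imp_continuous_on)
          then obtain z0 where z0: "z0 \<in> K" "\<And>z. z \<in> K \<Longrightarrow> norm (g z0) \<le> norm (g z)"
            using continuous_attains_inf[OF K(1) False] by blast
          define d where "d = norm (g z0)"
          have d: "d > 0"
            using z0(1) nz K(2) by (auto simp: d_def)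
          have "\<forall>\<^sub>F n in sequentially. \<forall>z\<in>K. dist ((j \<circ> s) n z) (g z) < d/2"
            using uniform_limitD[OF ul[OF K], of "d/2"] d by simp
          then obtain n0 where n0: "\<And>n z. n \<ge> n0 \<Longrightarrow> z \<in> K \<Longrightarrow> dist ((j \<circ> s) n z) (g z) < d/2"
            unfolding eventually_sequentially by blast
          have late: "norm (k ((r \<circ> s) n) z) \<le> 2 / d" if "n \<ge> n0" "z \<in> K" for n z
          proof -
            have "norm ((j \<circ> s) n z) > d / 2"
              using n0[OF that] z0(2)[OF that(2)] norm_triangle_ineq2[of "g z" "(j \<circ> s) n z"]
              by (simp add: d_def dist_norm norm_minus_commute)
            then have "norm (inverse ((j \<circ> s) n z)) < inverse (d / 2)"
              unfolding norm_inverse using d by (intro less_imp_inverse_less) auto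
            then show ?thesis
              by (simp add: j_def)
          qed
          have "\<exists>C. C \<ge> 0 \<and> (\<forall>z\<in>K. norm (k i z) \<le> C)" for i
          proof -
            have "compact (k i ` K)"
              using K holk by (intro compact_continuous_image) (meson continuous_on_subset holomorphic_on_imp_continuous_on)
            then have "bounded (k i ` K)"
              by (rule compact_imp_bounded)
            then obtain C where "\<forall>y\<in>k i ` K. norm y \<le> C"
              unfolding bounded_iff ..
            then show ?thesis
              by (intro exI[of _ "max 0 C"]) (auto simp: le_max_iff_disj)
          qed
          then obtain C where C: "\<And>i. C i \<ge> 0" "\<And>i z. z \<in> K \<Longrightarrow> norm (k i z) \<le> C i"
            by metis
          \<comment> \<open>Montel's theorem wants a bound for every index; the sum takes care of
            the first \<open>n0\<close>.\<close>
          have "norm (k ((r \<circ> s) i) z) \<le> 2 / d + (\<Sum>i<n0. C ((r \<circ> s) i))" if z: "z \<in> K" for i z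
          proof (cases "i < n0")
            case True
            have "norm (k ((r \<circ> s) i) z) \<le> C ((r \<circ> s) i)"
              using C(2) z by blast
            also have "\<dots> \<le> (\<Sum>i<n0. C ((r \<circ> s) i))"
              using True C(1) by (intro member_le_sum) auto
            finally show ?thesis
              using d by (simp add: add_increasing)
          next
            case False
            then show ?thesis
              using late[of i z] z C(1) by (simp add: add_increasing2 sum_nonneg)
          qed
          then show ?thesis by (intro exI allI ballI)
        qed auto
      qed
    qed
  qed
qed

section \<open>Blow-up of discs meeting the Julia set\<close>

lemma compact_subset_incseq:
  fixes E :: "nat \<Rightarrow> 'a::topological_space set"
  assumes K: "compact K" "K \<subseteq> (\<Union>n. E n)" and E: "\<And>n. open (E n)" "\<And>m n. m \<le> n \<Longrightarrow> E m \<subseteq> E n"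
  obtains n where "K \<subseteq> E n"
proof -
  obtain N where N: "finite N" "K \<subseteq> (\<Union>n\<in>N. E n)"
    by (rule compactE_image[OF K(1) E(1) K(2)])
  have "(\<Union>n\<in>N. E n) \<subseteq> E (Max (insert 0 N))"
  proof (rule UN_least)
    fix n assume "n \<in> N"
    then show "E n \<subseteq> E (Max (insert 0 N))"
      using N(1) by (intro E(2) Max_ge) auto
  qed
  then show ?thesis
    using N(2) that by (meson order_trans)
qed

locale nonconstant_entire =
  fixes f :: "complex \<Rightarrow> complex"
  assumes hol: "f holomorphic_on UNIV" and nonconst: "\<not> f constant_on UNIV"
begin

lemmas holomorphic_iterate = holomorphic_on_funpow[OF hol]

lemma continuous_iterate: "continuous_on S (f ^^ n)"
  by (meson continuous_on_subset holomorphic_iterate holomorphic_on_imp_continuous_on subset_UNIV)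

lemma open_iterate_image:
  assumes "open S"
  shows "open ((f ^^ n) ` S)"
proof (induction n)
  case (Suc n)
  have "(f ^^ Suc n) ` S = f ` (f ^^ n) ` S"
    by (simp add: image_comp)
  then show ?case
    using open_mapping_thm[OF hol open_UNIV connected_UNIV Suc.IH] nonconst by simp
qed (use assms in simp)

lemma iterate_image_add: "(f ^^ (m + n)) ` S = (f ^^ m) ` (f ^^ n) ` S"
  by (simp add: funpow_add image_comp)

lemma filled_iterate_mono:
  assumes "S \<subseteq> filled T" "open T"
  shows "filled ((f ^^ n) ` S) \<subseteq> filled ((f ^^ n) ` T)"
  using image_filled_subset_open[OF holomorphic_iterate assms(2), of n] assms(1)
  by (intro filled_subset_filled) blast

text \<open>By little Picard \<open>f\<close> omits at most one value \<open>p\<close>. A circle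
  missing \<open>p\<close> is a compact part of the range, so the image of some disc covers it, and
  filling covers the disc it bounds.\<close>

lemma ball_subset_filled_image:
  obtains R' where "ball 0 R \<subseteq> filled (f ` ball 0 R')"
proof -
  have "\<exists>p. \<forall>y. y \<noteq> p \<longrightarrow> y \<in> range f"
  proof (rule ccontr)
    assume "\<nexists>p. \<forall>y. y \<noteq> p \<longrightarrow> y \<in> range f"
    then obtain a b where "a \<noteq> b" "a \<notin> range f" "b \<notin> range f"
      by metis
    then obtain c where "f = (\<lambda>x. c)"
      using little_Picard[OF hol, of a b] by blast
    then show False
      using nonconst by (auto simp: constant_on_def)
  qed
  then obtain p where p: "\<And>y. y \<noteq> p \<Longrightarrow> y \<in> range f"
    by blast
  obtain r where r: "r \<ge> R" "r \<noteq> norm p"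
    by (metis order_refl linorder_le_cases lt_ex gt_ex less_le_not_le order_less_imp_le)
  have "sphere 0 r \<subseteq> (\<Union>n. f ` ball 0 (real n))"
  proof
    fix y :: complex assume "y \<in> sphere 0 r"
    then have "y \<noteq> p"
      using r(2) by auto
    then obtain x where "y = f x"
      using p by blast
    moreover obtain n where "norm x < real n"
      using reals_Archimedean2 by blast
    ultimately show "y \<in> (\<Union>n. f ` ball 0 (real n))"
      by (intro UN_I[of n] image_eqI) auto
  qed
  moreover have "open (f ` ball 0 (real n))" for n
    using open_iterate_image[of "ball 0 (real n)" 1] by simp
  ultimately obtain n where "sphere 0 r \<subseteq> f ` ball 0 (real n)"
    by (rule compact_subset_incseq[OF compact_sphere]) (auto intro: less_le_trans)
  then have "ball 0 r \<subseteq> filled (f ` ball 0 (real n))"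
    by (rule ball_subset_filled)
  then show ?thesis
    using r(1) that subset_ball[of R r 0] by blast
qed

lemma ball_subset_filled_iterate_image:
  "\<exists>R'. ball 0 R \<subseteq> filled ((f ^^ n) ` ball 0 R')"
proof (induction n)
  case 0
  show ?case
    using subset_filled by fastforce
next
  case (Suc n)
  then obtain R1 where R1: "ball 0 R \<subseteq> filled ((f ^^ n) ` ball 0 R1)"
    by blast
  obtain R2 where R2: "ball 0 R1 \<subseteq> filled (f ` ball 0 R2)"
    by (rule ball_subset_filled_image)
  have "filled ((f ^^ n) ` ball 0 R1) \<subseteq> filled ((f ^^ n) ` f ` ball 0 R2)"
    using open_iterate_image[of "ball 0 R2" 1] by (intro filled_iterate_mono[OF R2]) simp
  also have "(f ^^ n) ` f ` ball 0 R2 = (f ^^ Suc n) ` ball 0 R2"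
    using iterate_image_add[of n 1] by simp
  finally show ?case
    using R1 by blast
qed

text \<open>Otherwise every late image misses a point on each circle about 0 of radius at least
  \<open>r\<close>. Points missed on the circles of radius \<open>r\<close> and \<open>2 * r\<close>
  are at least \<open>r\<close> apart, so \<open>spherically_subconvergent_omitting\<close> would
  make the iterates normal on the disc.\<close>

lemma frequently_ball_subset_filled_iterate:
  assumes J: "ball c \<rho> \<inter> Julia_set f \<noteq> {}"
  obtains n where "n \<ge> n0" "ball 0 R \<subseteq> filled ((f ^^ n) ` ball c \<rho>)"
proof (rule ccontr)
  assume "\<not> thesis"
  then have no: "\<not> ball 0 R \<subseteq> filled ((f ^^ n) ` ball c \<rho>)" if "n \<ge> n0" for n
    using that \<open>\<And>n. \<lbrakk>n \<ge> n0; ball 0 R \<subseteq> filled ((f ^^ n) ` ball c \<rho>)\<rbrakk> \<Longrightarrow> thesis\<close> by blast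
  define r where "r = max R 1"
  have omit: "\<exists>a. norm a = s \<and> a \<notin> (f ^^ n) ` ball c \<rho>" if "n \<ge> n0" "s \<ge> r" for n s
  proof (rule ccontr)
    assume "\<not> ?thesis"
    then have "ball 0 s \<subseteq> filled ((f ^^ n) ` ball c \<rho>)"
      by (intro ball_subset_filled) auto
    moreover have "ball 0 R \<subseteq> ball (0::complex) s"
      using that(2) by (intro subset_ball) (simp add: r_def)
    ultimately show False
      using no[OF that(1)] by blast
  qed
  have "normal_family_on (ball c \<rho>) {f ^^ n |n. n \<ge> 1}"
  proof (rule normal_family_on_iterates[OF hol])
    fix m :: "nat \<Rightarrow> nat" assume m: "\<And>i. n0 \<le> m i"
    obtain a where a: "\<And>i. norm (a i) = r" "\<And>i. a i \<notin> (f ^^ m i) ` ball c \<rho>"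
      using omit[OF m order_refl] by metis
    have "r \<le> 2 * r"
      using r_def by linarith
    then obtain b where b: "\<And>i. norm (b i) = 2 * r" "\<And>i. b i \<notin> (f ^^ m i) ` ball c \<rho>"
      using omit[OF m] by metis
    show "spherically_subconvergent (ball c \<rho>) (\<lambda>i. f ^^ m i)"
    proof (rule spherically_subconvergent_omitting[where M = "2 * r" and \<delta> = r])
      show "r \<le> norm (b i - a i)" for i
        using norm_triangle_ineq2[of "b i" "a i"] a(1) b(1) by simp
      show "f ^^ m i holomorphic_on ball c \<rho>" for i
        by (rule holomorphic_on_subset[OF holomorphic_iterate]) simp
      show "0 < r" "norm (a i) \<le> 2 * r" "norm (b i) \<le> 2 * r" for i
        using a(1) b(1) \<open>r \<le> 2 * r\<close> by (simp_all add: r_def)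
      show "(f ^^ m i) z \<noteq> a i \<and> (f ^^ m i) z \<noteq> b i" if "z \<in> ball c \<rho>" for i z
        using imageI[OF that, of "f ^^ m i"] a(2)[of i] b(2)[of i] by metis
    qed auto
  qed
  then have "ball c \<rho> \<subseteq> Fatou_set f"
    unfolding Fatou_set_def by (auto intro!: exI[of _ "ball c \<rho>"])
  then show False
    using J by (auto simp: Julia_set_def)
qed

text \<open>Once \<open>filled (f\<^sup>N(D)) \<supseteq> D\<close>, the filled images increase along residue classes modulo \<open>N\<close>, and a
  very large disc inside one of them is carried to large discs in all residue classes.\<close>

lemma eventually_ball_subset_filled_iterate:
  assumes J: "ball c \<rho> \<inter> Julia_set f \<noteq> {}"
  shows "\<forall>\<^sub>F n in sequentially. ball 0 R \<subseteq> filled ((f ^^ n) ` ball c \<rho>)"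
proof -
  let ?P = "\<lambda>n. filled ((f ^^ n) ` ball c \<rho>)"
  obtain M where M: "ball c \<rho> \<subseteq> ball 0 M"
    using bounded_subset_ballD[OF bounded_ball] by blast
  obtain N where N: "N \<ge> 1" "ball 0 M \<subseteq> ?P N"
    by (rule frequently_ball_subset_filled_iterate[OF J])
  have step: "?P n \<subseteq> ?P (n + N)" for n
    using filled_iterate_mono[of "ball c \<rho>" "(f ^^ N) ` ball c \<rho>" n] M N(2) open_iterate_image
    by (simp add: iterate_image_add)
  have steps: "?P n \<subseteq> ?P (n + j * N)" for n j
  proof (induction j)
    case (Suc j)
    then show ?case
      using step[of "n + j * N"] by (simp add: add.assoc add.commute[of N])
  qed simp
  have "\<forall>s. \<exists>R'. ball 0 R \<subseteq> filled ((f ^^ s) ` ball 0 R')"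
    using ball_subset_filled_iterate_image by blast
  then obtain Q where Q: "\<And>s. ball 0 R \<subseteq> filled ((f ^^ s) ` ball 0 (Q s))"
    by metis
  \<comment> \<open>\<open>Q s\<close> is a radius that suffices for \<open>s\<close> further steps;
    the maximum serves all residues modulo \<open>N\<close> at once.\<close>
  define Q' where "Q' = Max (Q ` {..N})"
  obtain n1 where n1: "n1 \<ge> 0" "ball 0 Q' \<subseteq> ?P n1"
    by (rule frequently_ball_subset_filled_iterate[OF J])
  have "ball 0 R \<subseteq> ?P n" if "n \<ge> n1" for n
  proof -
    define s where "s = (n - n1) mod N"
    define j where "j = (n - n1) div N"
    have n: "n = s + n1 + j * N"
      using that by (simp add: s_def j_def)
    have "s < N"
      using N(1) by (simp add: s_def)
    then have "Q s \<le> Q'"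
      unfolding Q'_def by (intro Max_ge) auto
    then have "ball 0 (Q s) \<subseteq> ?P n1"
      using n1(2) subset_ball by blast
    then have "filled ((f ^^ s) ` ball 0 (Q s)) \<subseteq> ?P (s + n1)"
      unfolding iterate_image_add by (rule filled_iterate_mono) (simp add: open_iterate_image)
    then show ?thesis
      using Q[of s] steps[of "s + n1" j] n by blast
  qed
  then show ?thesis
    unfolding eventually_sequentially by blast
qed

end

section \<open>Connectedness criteria\<close>

text \<open>\<open>filled_disjoint\<close> says that \<open>S\<close> together with the point at infinity is connected, so that a
  separation of \<open>S\<close> would show up inside one of the loops \<open>\<partial>\<Omega>\<close>.\<close>

lemma connected_via_loops:
  fixes S :: "complex set"
  assumes S: "closed S"
    and filled_disjoint: "\<And>K. compact K \<Longrightarrow> K \<inter> S = {} \<Longrightarrow> inside K \<inter> S = {}"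
    and loops: "\<And>R. \<exists>\<Omega>. open \<Omega> \<and> bounded \<Omega> \<and> connected (frontier \<Omega>) \<and> frontier \<Omega> \<subseteq> S \<and> ball 0 R \<subseteq> \<Omega>"
  shows "connected S"
  unfolding connected_closed_set[OF S]
proof
  assume "\<exists>A B. closed A \<and> closed B \<and> A \<noteq> {} \<and> B \<noteq> {} \<and> A \<union> B = S \<and> A \<inter> B = {}"
  then obtain A B a b where AB: "closed A" "closed B" "A \<union> B = S" "A \<inter> B = {}" "a \<in> A" "b \<in> B"
    by blast
  \<comment> \<open>Since \<open>frontier \<Omega>\<close> misses \<open>A\<close>, the part of
    \<open>A\<close> inside \<Omega> is compact, while the rest of \<open>S\<close> is closed. A
    compact set between them misses \<open>S\<close> but has \<open>a\<close> inside, against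
    \<open>filled_disjoint\<close>.\<close>
  have separated: False
    if A: "closed A" "closed B" "A \<union> B = S" "A \<inter> B = {}" "a \<in> A"
      and \<Omega>: "open \<Omega>" "bounded \<Omega>" "a \<in> \<Omega>" "frontier \<Omega> \<inter> A = {}" for A B \<Omega> a
  proof -
    have "A \<inter> \<Omega> = A \<inter> closure \<Omega>"
      using \<Omega>(1,4) by (auto simp: frontier_def interior_open closure_def)
    moreover have "compact (A \<inter> closure \<Omega>)"
      using A(1) \<Omega>(2) by (simp add: closed_Int_compact compact_closure)
    ultimately have "compact (A \<inter> \<Omega>)"
      by simp
    moreover have "closed (B \<union> (A - \<Omega>))"
      using A \<Omega>(1) by (intro closed_Un closed_Diff)
    moreover have "(A \<inter> \<Omega>) \<inter> (B \<union> (A - \<Omega>)) = {}" "a \<in> A \<inter> \<Omega>"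
      using A \<Omega> by auto
    ultimately obtain K where K: "compact K" "K \<inter> (A \<inter> \<Omega>) = {}" "K \<inter> (B \<union> (A - \<Omega>)) = {}" "a \<in> inside K"
      by (rule compact_separated)
    then have "K \<inter> S = {}"
      using A(3) by blast
    then have "inside K \<inter> S = {}"
      using K(1) by (intro filled_disjoint)
    then show False
      using K(4) A(3,5) by blast
  qed
  \<comment> \<open>The loop goes around both \<open>a\<close> and \<open>b\<close>. Being
    connected, it lies on one side of the separation, and \<open>separated\<close> refutes the other
    side.\<close>
  obtain \<Omega> where \<Omega>: "open \<Omega>" "bounded \<Omega>" "connected (frontier \<Omega>)" "frontier \<Omega> \<subseteq> S"
      "ball 0 (norm a + norm b + 1) \<subseteq> \<Omega>"
    using loops by blast
  have ab: "a \<in> \<Omega>" "b \<in> \<Omega>"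
    using norm_ge_zero[of a] norm_ge_zero[of b] by (intro subsetD[OF \<Omega>(5)]; simp del: norm_ge_zero)+
  have "A \<inter> frontier \<Omega> = {} \<or> B \<inter> frontier \<Omega> = {}"
    using \<Omega>(3) AB \<Omega>(4) by (intro connected_closedD) auto
  then show False
  proof
    assume "A \<inter> frontier \<Omega> = {}"
    then show False
      using separated[OF AB(1-5) \<Omega>(1,2) ab(1)] by blast
  next
    assume "B \<inter> frontier \<Omega> = {}"
    then show False
      using separated[OF AB(2,1) _ _ AB(6) \<Omega>(1,2) ab(2)] AB(3,4) by blast
  qed
qed

context nonconstant_entire
begin

lemma iterate_add_apply: "(f ^^ m) ((f ^^ n) z) = (f ^^ (m + n)) z"
  by (simp add: funpow_add)

text \<open>A component \<open>W\<close> of \<open>-S\<close> containing an escaping point eventually leaves every loop in \<open>S\<close>, so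
  even the closure of \<open>W\<close> escapes; if \<open>W\<close> could be separated from \<open>S\<close>, it would be open and closed.\<close>

lemma connected_escaping_set_via_loops:
  assumes S: "connected S" "S \<noteq> {}" "S \<subseteq> escaping_set f"
    and backward: "\<And>n z. (f ^^ n) z \<in> S \<Longrightarrow> z \<in> S"
    and loops: "\<And>R. \<exists>\<Omega>. open \<Omega> \<and> bounded \<Omega> \<and> frontier \<Omega> \<subseteq> S \<and> ball 0 R \<subseteq> \<Omega>"
  shows "connected (escaping_set f)"
proof -
  let ?I = "escaping_set f"
  let ?W = "connected_component_set (- S)"
  have escapes: "closure (?W z) \<subseteq> ?I" if z: "z \<in> ?I" "z \<notin> S" for z
  proof
    fix u assume u: "u \<in> closure (?W z)"
    have "\<forall>\<^sub>F n in sequentially. R \<le> norm ((f ^^ n) u)" for R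
    proof -
      obtain \<Omega> where \<Omega>: "open \<Omega>" "bounded \<Omega>" "frontier \<Omega> \<subseteq> S" "ball 0 R \<subseteq> \<Omega>"
        using loops by blast
      \<comment> \<open>Once the orbit of \<open>z\<close> has modulus at least \<open>M\<close> it
        is off \<Omega>. The connected image of \<open>?W z\<close> misses \<open>S\<close>, hence
        \<open>frontier \<Omega>\<close>, so all of it is off \<Omega>.\<close>
      obtain M where M: "M > 0" "\<And>x. x \<in> \<Omega> \<Longrightarrow> norm x < M"
        using \<Omega>(2) bounded_pos_less by metis
      have "\<forall>\<^sub>F n in sequentially. M \<le> norm ((f ^^ n) z)"
        using z(1) M(1) by (simp add: escaping_set_def filterlim_at_infinity[of 0])
      then show ?thesis
      proof eventually_elim
        case (elim n)
        have conn: "connected ((f ^^ n) ` ?W z)"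
          by (intro connected_continuous_image continuous_iterate) simp
        have "?W z \<subseteq> - S"
          by (rule connected_component_subset)
        then have "(f ^^ n) ` ?W z \<inter> S = {}"
          using backward by blast
        then have no: "(f ^^ n) ` ?W z \<inter> frontier \<Omega> = {}"
          using \<Omega>(3) by blast
        have "z \<in> ?W z"
          using z(2) by simp
        then have "(f ^^ n) z \<in> (f ^^ n) ` ?W z - \<Omega>"
          using elim M(2)[of "(f ^^ n) z"] by auto
        then have disj: "(f ^^ n) ` ?W z \<inter> \<Omega> = {}"
          using connected_Int_frontier[OF conn] no by blast
        have "(f ^^ n) ` closure (?W z) \<subseteq> closure ((f ^^ n) ` ?W z)"
          by (intro image_closure_subset continuous_iterate closure_subset) auto
        moreover have "closure ((f ^^ n) ` ?W z) \<inter> \<Omega> = {}"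
          using disj open_Int_closure_eq_empty[OF \<Omega>(1)] by blast
        ultimately have "(f ^^ n) u \<notin> \<Omega>"
          using u by blast
        then show ?case
          using \<Omega>(4) by (auto simp: subset_iff not_less)
      qed
    qed
    then show "u \<in> ?I"
      by (simp add: escaping_set_def filterlim_at_infinity[of 0])
  qed
  have separated: "P2 \<inter> ?I = {}"
    if P: "open P1" "open P2" "P1 \<inter> P2 \<inter> ?I = {}" "?I \<subseteq> P1 \<union> P2" "P2 \<inter> S = {}" for P1 P2
  proof (rule ccontr)
    assume "P2 \<inter> ?I \<noteq> {}"
    then obtain z where z: "z \<in> P2" "z \<in> ?I" by blast
    then have zS: "z \<notin> S"
      using P(5) by blast
    let ?T = "connected_component_set P2 z"
    have zW: "z \<in> ?W z"
      using zS by simp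
    have W: "connected (closure (?W z))" "z \<in> closure (?W z)"
      using zW closure_subset[of "?W z"] by (auto intro: connected_imp_connected_closure)
    have "P1 \<inter> closure (?W z) = {} \<or> P2 \<inter> closure (?W z) = {}"
      using P escapes[OF z(2) zS] connectedD[OF W(1) P(1,2)] by blast
    then have "closure (?W z) \<subseteq> P2"
      using z(1) W(2) escapes[OF z(2) zS] P(4) by blast
    \<comment> \<open>As \<open>P2\<close> misses \<open>S\<close>, the component \<open>?T\<close>
      lies in \<open>?W z\<close>; so \<open>?W z\<close>, its closure and \<open>?T\<close>
      coincide.\<close>
    then have 1: "closure (?W z) \<subseteq> ?T"
      using W by (intro connected_component_maximal)
    have "?T \<subseteq> P2"
      by (rule connected_component_subset)
    then have 2: "?T \<subseteq> ?W z"
      using z(1) P(5) by (intro connected_component_maximal) auto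
    have "?W z = ?T" "?W z = closure (?W z)"
      using 1 2 closure_subset[of "?W z"] by blast+
    moreover have "open ?T"
      using P(2) by (rule open_connected_component)
    ultimately have "open (?W z)" "closed (?W z)"
      using closed_closure[of "?W z"] by metis+
    then have "?W z = UNIV"
      using clopen[of "?W z"] zW by (metis empty_iff)
    moreover have "?W z \<subseteq> - S"
      by (rule connected_component_subset)
    ultimately show False
      using S(2) by blast
  qed
  show ?thesis
    unfolding connected_def
  proof (rule notI, elim exE conjE)
    fix P1 P2
    assume P: "open P1" "open P2" "?I \<subseteq> P1 \<union> P2" "P1 \<inter> P2 \<inter> ?I = {}" "P1 \<inter> ?I \<noteq> {}" "P2 \<inter> ?I \<noteq> {}"
    have "P1 \<inter> S = {} \<or> P2 \<inter> S = {}"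
      using P S connectedD[OF S(1) P(1,2)] by blast
    then show False
    proof
      assume "P1 \<inter> S = {}"
      moreover have "P2 \<inter> P1 \<inter> ?I = {}" "?I \<subseteq> P2 \<union> P1"
        using P by blast+
      ultimately show False
        using separated[OF P(2,1)] P(5) by blast
    next
      assume "P2 \<inter> S = {}"
      then show False
        using separated[OF P(1,2,4,3)] P(6) by blast
    qed
  qed
qed

section \<open>Orbits avoiding the filled images of a disc\<close>

text \<open>This is the preimage of \<open>B_disc f D\<close> under \<open>f ^^ L\<close>; one
  connectedness argument then covers \<open>B_disc\<close> and all the pieces of
  \<open>B_set\<close>.\<close>

definition avoiding :: "complex set \<Rightarrow> nat \<Rightarrow> complex set" where
  "avoiding D L = {z. \<forall>n\<ge>1. (f ^^ (n + L)) z \<notin> filled ((f ^^ n) ` D)}"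

lemma B_disc_eq: "B_disc f D = avoiding D 0"
  by (simp add: B_disc_def avoiding_def)

lemma B_set_eq: "B_set f D = (\<Union>L\<in>{1..}. avoiding D L)"
  by (auto simp: B_set_def avoiding_def)

text \<open>The trapping property given by the maximum principle: an orbit that enters one of the
  filled images stays in the later ones.\<close>

lemma image_iterate_filled_subset:
  assumes "open D"
  shows "(f ^^ m) ` filled ((f ^^ n) ` D) \<subseteq> filled ((f ^^ (m + n)) ` D)"
  unfolding iterate_image_add
  using assms by (intro image_filled_subset_open holomorphic_iterate open_iterate_image)

text \<open>By trapping, the complement is an increasing union of open sets \<open>E n\<close>. A
  compact set in it lies in a single \<open>E n\<close>, and the maximum principle puts its inside
  there too, as \<open>connected_via_loops\<close> requires.\<close>

lemma connected_avoiding: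
  assumes D: "open D"
    and loops: "\<And>R. \<exists>\<Omega>. open \<Omega> \<and> bounded \<Omega> \<and> connected (frontier \<Omega>) \<and>
                  frontier \<Omega> \<subseteq> avoiding D L \<and> ball 0 R \<subseteq> \<Omega>"
  shows "connected (avoiding D L)"
proof -
  define E where "E n = (f ^^ (Suc n + L)) -` filled ((f ^^ Suc n) ` D)" for n
  have compl: "- avoiding D L = (\<Union>n. E n)"
  proof -
    have *: "(\<exists>n\<ge>1. P n) \<longleftrightarrow> (\<exists>n. P (Suc n))" for P
      by (metis Suc_le_D Suc_le_eq One_nat_def zero_less_Suc)
    have "- avoiding D L = {z. \<exists>n\<ge>1. (f ^^ (n + L)) z \<in> filled ((f ^^ n) ` D)}"
      by (auto simp: avoiding_def)
    then show ?thesis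
      unfolding * E_def by blast
  qed
  have open_E: "open (E n)" for n
    unfolding E_def using D by (intro open_vimage open_filled open_iterate_image continuous_iterate)
  have mono_E: "E m \<subseteq> E n" if "m \<le> n" for m n
  proof
    fix z assume "z \<in> E m"
    then have "(f ^^ (n - m)) ((f ^^ (Suc m + L)) z) \<in> filled ((f ^^ (n - m + Suc m)) ` D)"
      using image_iterate_filled_subset[OF D, of "n - m" "Suc m"] by (auto simp: E_def)
    moreover have "n - m + (Suc m + L) = Suc n + L" "n - m + Suc m = Suc n"
      using that by simp_all
    ultimately show "z \<in> E n"
      unfolding iterate_add_apply by (simp only: E_def vimage_eq)
  qed
  show ?thesis
  proof (rule connected_via_loops[OF _ _ loops])
    have "open (- avoiding D L)"
      unfolding compl using open_E by blast
    then show "closed (avoiding D L)"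
      by (simp add: closed_def)
    fix K assume K: "compact K" "K \<inter> avoiding D L = {}"
    then have "K \<subseteq> (\<Union>n. E n)"
      using compl by blast
    then obtain n where n: "K \<subseteq> E n"
      by (rule compact_subset_incseq[OF K(1) _ open_E mono_E])
    have "inside K \<subseteq> E n"
    proof
      fix x assume "x \<in> inside K"
      then have "(f ^^ (Suc n + L)) x \<in> filled ((f ^^ (Suc n + L)) ` K)"
        using image_filled_subset_compact[OF holomorphic_iterate K(1)] unfolding filled_def[of K] by blast
      moreover have "filled ((f ^^ (Suc n + L)) ` K) \<subseteq> filled ((f ^^ Suc n) ` D)"
        using n unfolding E_def by (intro filled_subset_filled) blast
      ultimately show "x \<in> E n"
        unfolding E_def by blast
    qed
    then show "inside K \<inter> avoiding D L = {}"
      using compl by blast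
  qed
qed

text \<open>Some filled iterated image of the primed disc swallows the other disc; if this takes
  \<open>m\<close> steps, raising the delay \<open>L\<close> by \<open>m\<close> suffices.\<close>

lemma B_set_subset:
  assumes "ball c' \<rho>' \<inter> Julia_set f \<noteq> {}"
  shows "B_set f (ball c' \<rho>') \<subseteq> B_set f (ball c \<rho>)"
proof
  fix z assume "z \<in> B_set f (ball c' \<rho>')"
  then obtain L where L: "L \<ge> 1" "\<And>n. n \<ge> 1 \<Longrightarrow> (f ^^ (n + L)) z \<notin> filled ((f ^^ n) ` ball c' \<rho>')"
    by (auto simp: B_set_def)
  obtain M where M: "ball c \<rho> \<subseteq> ball 0 M"
    using bounded_subset_ballD[OF bounded_ball] by blast
  obtain m where m: "m \<ge> 0" "ball 0 M \<subseteq> filled ((f ^^ m) ` ball c' \<rho>')"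
    by (rule frequently_ball_subset_filled_iterate[OF assms])
  have "(f ^^ (n + (m + L))) z \<notin> filled ((f ^^ n) ` ball c \<rho>)" if "n \<ge> 1" for n
  proof -
    have "filled ((f ^^ n) ` ball c \<rho>) \<subseteq> filled ((f ^^ (n + m)) ` ball c' \<rho>')"
      unfolding iterate_image_add using M m(2) by (intro filled_iterate_mono open_iterate_image) auto
    then show ?thesis
      using L(2)[of "n + m"] that by (auto simp: add.assoc)
  qed
  then show "z \<in> B_set f (ball c \<rho>)"
    using L(1) by (auto simp: B_set_def intro!: exI[of _ "m + L"])
qed

text \<open>The filled images eventually contain any given disc about 0, so an orbit avoiding them
  must leave that disc for good.\<close>

lemma B_set_subset_escaping_set:
  assumes J: "ball c \<rho> \<inter> Julia_set f \<noteq> {}"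
  shows "B_set f (ball c \<rho>) \<subseteq> escaping_set f"
proof
  fix z assume "z \<in> B_set f (ball c \<rho>)"
  then obtain L where L: "\<And>n. n \<ge> 1 \<Longrightarrow> (f ^^ (n + L)) z \<notin> filled ((f ^^ n) ` ball c \<rho>)"
    by (auto simp: B_set_def)
  have "\<forall>\<^sub>F n in sequentially. R \<le> norm ((f ^^ n) z)" for R
  proof -
    have "\<forall>\<^sub>F n in sequentially. R \<le> norm ((f ^^ (n + L)) z)"
      using eventually_ball_subset_filled_iterate[OF J, of R] eventually_ge_at_top[of 1]
    proof eventually_elim
      case (elim n)
      then have "(f ^^ (n + L)) z \<notin> ball 0 R"
        using L[of n] by blast
      then show ?case by simp
    qed
    then show ?thesis
      by (subst (asm) eventually_sequentially_seg)
  qed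
  then show "z \<in> escaping_set f"
    by (simp add: escaping_set_def filterlim_at_infinity[of 0])
qed

lemma B_set_backward:
  assumes "(f ^^ m) z \<in> B_set f D"
  shows "z \<in> B_set f D"
proof -
  obtain L where L: "L \<ge> 1" "\<And>n. n \<ge> 1 \<Longrightarrow> (f ^^ (n + L)) ((f ^^ m) z) \<notin> filled ((f ^^ n) ` D)"
    using assms by (auto simp: B_set_def)
  have "(f ^^ (n + (L + m))) z \<notin> filled ((f ^^ n) ` D)" if "n \<ge> 1" for n
    using L(2)[OF that] unfolding iterate_add_apply by (simp add: add.assoc)
  then show ?thesis
    using L(1) by (auto simp: B_set_def intro!: exI[of _ "L + m"])
qed

section \<open>The domain bounded by the pulled back curves\<close>

text \<open>\<open>U\<close> is the limit of the components \<open>V n\<close> of the set of points whose orbits stay in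
  \<open>G N, \<dots>, G (N + n)\<close>. An orbit starting on \<open>\<partial>V n\<close> leaves at the last step, hence cannot be in
  \<open>filled (f\<^sup>N\<^sup>+\<^sup>k(D))\<close> at an earlier time \<open>k\<close>.\<close>

lemma surrounding_domain:
  assumes D: "open D" "connected D" "D \<noteq> {}"
    and G: "\<And>n. n \<ge> 1 \<Longrightarrow> open (G n)" "\<And>n. n \<ge> 1 \<Longrightarrow> bounded (G n)"
    and DG: "\<And>n. n \<ge> 1 \<Longrightarrow> filled ((f ^^ n) ` D) \<subseteq> G n"
    and frG: "\<And>n z. n \<ge> 1 \<Longrightarrow> z \<in> frontier (G n) \<Longrightarrow> f z \<notin> G (Suc n)"
    and N: "N \<ge> 1"
  obtains U where "open U" "connected U" "bounded U" "(f ^^ N) ` D \<subseteq> U"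
    "\<And>z k. z \<in> frontier U \<Longrightarrow> (f ^^ k) z \<notin> filled ((f ^^ (k + N)) ` D)"
proof -
  define H where "H n = (\<Inter>k\<le>n. (f ^^ k) -` G (k + N))" for n
  have N': "k + N \<ge> 1" for k
    using N by simp
  have openH: "open (H n)" for n
    unfolding H_def using G(1)[OF N'] by (intro open_INT ballI open_vimage continuous_iterate) auto
  obtain z0 where z0: "z0 \<in> (f ^^ N) ` D"
    using D(3) by blast
  have DN: "connected ((f ^^ N) ` D)"
    using D(2) by (intro connected_continuous_image continuous_iterate)
  define V where "V n = connected_component_set (H n) z0" for n
  have openV: "open (V n)" for n
    unfolding V_def using openH by (rule open_connected_component)
  have VH: "V n \<subseteq> H n" for n
    unfolding V_def by (rule connected_component_subset)
  have DV: "(f ^^ N) ` D \<subseteq> V n" for n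
  proof -
    have "(f ^^ N) ` D \<subseteq> H n"
    proof -
      have "(f ^^ k) ` (f ^^ N) ` D \<subseteq> G (k + N)" for k
        using DG[OF N', of k] subset_filled by (metis iterate_image_add order_trans)
      then show ?thesis
        unfolding H_def by blast
    qed
    then show ?thesis
      unfolding V_def using z0 DN by (intro connected_component_maximal)
  qed
  have V_mono: "V n \<subseteq> V m" if "m \<le> n" for m n
    unfolding V_def using that by (intro connected_component_mono) (auto simp: H_def)
  \<comment> \<open>A point of \<open>frontier (V n)\<close> is not in \<open>H n\<close>, because
    \<open>V n\<close> is closed in \<open>H n\<close>; so its orbit is off some
    \<open>G (k + N)\<close> with \<open>k \<le> n\<close>. Still in the closure, it is then on the
    frontier, and \<open>frG\<close> carries the failure from each step to the next, up to
    \<open>n\<close>.\<close>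
  have frV: "(f ^^ n) z \<notin> G (n + N)" if z: "z \<in> frontier (V n)" for n z
  proof -
    have z': "z \<in> closure (V n)" "z \<notin> V n"
      using z openV[of n] by (auto simp: frontier_def interior_open)
    have cl: "(f ^^ k) z \<in> closure (G (k + N))" if "k \<le> n" for k
    proof -
      have "(f ^^ k) ` V n \<subseteq> G (k + N)"
        using VH[of n] that unfolding H_def by blast
      then have "(f ^^ k) ` closure (V n) \<subseteq> closure (G (k + N))"
        using closure_subset by (intro image_closure_subset continuous_iterate) (auto intro: order_trans)
      then show ?thesis
        using z'(1) by blast
    qed
    have "z \<notin> H n"
    proof
      assume "z \<in> H n"
      moreover have "closedin (top_of_set (H n)) (V n)"
        unfolding V_def by (rule closedin_connected_component)
      ultimately show False
        using z' closedin_closed[of "H n" "V n"] closure_minimal[of "V n"] by blast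
    qed
    then obtain k where k: "k \<le> n" "(f ^^ k) z \<notin> G (k + N)"
      unfolding H_def by blast
    show ?thesis
      using k(1)
    proof (induction rule: dec_induct)
      case (step j)
      then have "(f ^^ j) z \<in> frontier (G (j + N))"
        using cl[of j] G(1)[OF N', of j] by (simp add: frontier_def interior_open)
      then show ?case
        using frG[OF N', of _ j] by simp
    qed (use k in simp)
  qed
  \<comment> \<open>A decreasing intersection of domains need be neither open nor connected, hence
    the passage to a component of the interior.\<close>
  define T where "T = (\<Inter>n. V n)"
  define U where "U = connected_component_set (interior T) z0"
  have openU: "open U" and connU: "connected U"
    unfolding U_def by (auto intro: open_connected_component)
  have "U \<subseteq> interior T"
    unfolding U_def by (rule connected_component_subset)
  then have UT: "U \<subseteq> T"
    using interior_subset by (rule order_trans)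
  have "V 0 \<subseteq> G N"
    using VH[of 0] by (auto simp: H_def)
  then have bddU: "bounded U"
    using UT G(2)[OF N] unfolding T_def by (meson INT_lower UNIV_I bounded_subset order_trans)
  have "(f ^^ N) ` D \<subseteq> interior T"
    using DV open_iterate_image[OF D(1)] by (intro interior_maximal) (auto simp: T_def)
  then have DU: "(f ^^ N) ` D \<subseteq> U"
    unfolding U_def using z0 DN by (intro connected_component_maximal)
  have "(f ^^ k) z \<notin> filled ((f ^^ (k + N)) ` D)" if z: "z \<in> frontier U" for z k
  proof
    let ?P = "(f ^^ k) -` filled ((f ^^ (k + N)) ` D)"
    assume "(f ^^ k) z \<in> filled ((f ^^ (k + N)) ` D)"
    moreover have "open ?P"
      using D(1) by (intro open_vimage open_filled open_iterate_image continuous_iterate)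
    ultimately obtain e where e: "e > 0" "ball z e \<subseteq> ?P"
      using open_contains_ball by (metis vimageI)
    have z': "z \<in> closure U" "z \<notin> U"
      using z openU by (auto simp: frontier_def interior_open)
    then have meets: "ball z e \<inter> U \<noteq> {}"
      using e(1) open_Int_closure_eq_empty[of "ball z e" U] centre_in_ball[of z e] by blast
    \<comment> \<open>A ball that meets \<open>V n\<close> without lying in it meets
      \<open>frontier (V n)\<close>. There \<open>frV\<close> puts the iterate \<open>f ^^ n\<close>
      off \<open>G (n + N)\<close>, whereas trapping keeps it in a filled image inside
      \<open>G (n + N)\<close>.\<close>
    have late: "ball z e \<subseteq> V n" if n: "k \<le> n" for n
    proof (rule ccontr)
      assume "\<not> ?thesis"
      moreover have "ball z e \<inter> V n \<noteq> {}"
        using meets UT unfolding T_def by blast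
      ultimately have "ball z e \<inter> frontier (V n) \<noteq> {}"
        by (intro connected_Int_frontier) auto
      then obtain y where y: "y \<in> ball z e" "y \<in> frontier (V n)"
        by blast
      have "(f ^^ (n - k)) ((f ^^ k) y) \<in> filled ((f ^^ (n - k + (k + N))) ` D)"
        using image_iterate_filled_subset[OF D(1), of "n - k" "k + N"] e(2) y(1) by blast
      moreover have "n - k + k = n" "n - k + (k + N) = n + N"
        using n by simp_all
      ultimately have "(f ^^ n) y \<in> G (n + N)"
        using DG[OF N', of n] unfolding iterate_add_apply by auto
      then show False
        using frV[OF y(2)] by blast
    qed
    have "ball z e \<subseteq> V n" for n
      using late[of "max n k"] V_mono[of n "max n k"] by auto
    then have "ball z e \<subseteq> interior T"
      by (intro interior_maximal) (auto simp: T_def)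
    then have "z \<in> interior T"
      using e(1) by auto
    \<comment> \<open>Relative closedness of \<open>U\<close> would put its boundary point
      \<open>z\<close> into \<open>U\<close>.\<close>
    moreover have "closedin (top_of_set (interior T)) U"
      unfolding U_def by (rule closedin_connected_component)
    ultimately show False
      using z' closedin_closed[of "interior T" U] closure_minimal[of U] by blast
  qed
  then show ?thesis
    using that[OF openU connU bddU DU] by blast
qed

end

text \<open>The closed exterior of the curve is connected and unbounded and misses \<open>S\<close>,
  so it misses \<open>filled S\<close> too; by the Jordan curve theorem its complement is the
  inside.\<close>

lemma filled_subset_inside_Jordan:
  assumes \<gamma>: "simple_path \<gamma>" "pathfinish \<gamma> = pathstart \<gamma>"
    and S: "surrounds (path_image \<gamma>) S"
  shows "filled S \<subseteq> inside (path_image \<gamma>)"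
proof -
  let ?g = "path_image \<gamma>"
  note J = Jordan_inside_outside[OF \<gamma>]
  obtain C where C: "C \<in> components (- ?g)" "bounded C" "S \<subseteq> C"
    using S by (auto simp: surrounds_def)
  have "C \<subseteq> inside ?g"
  proof
    fix x assume "x \<in> C"
    moreover have "C = connected_component_set (- ?g) x" "C \<subseteq> - ?g"
      using C(1) \<open>x \<in> C\<close> in_components_subset[OF C(1)]
      by (metis components_iff connected_component_eq, simp)
    ultimately show "x \<in> inside ?g"
      using C(2) by (auto simp: inside_def)
  qed
  moreover have compl: "closure (outside ?g) = - inside ?g"
  proof -
    have "closure (outside ?g) = outside ?g \<union> ?g"
      using J by (metis closure_Un_frontier)
    then show ?thesis
      using J by blast
  qed
  ultimately have "closure (outside ?g) \<inter> S = {}"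
    using C(3) by blast
  moreover have "connected (closure (outside ?g))" "\<not> bounded (closure (outside ?g))"
    using J by (auto intro: connected_imp_connected_closure dest: bounded_subset[OF _ closure_subset])
  ultimately have "closure (outside ?g) \<inter> filled S = {}"
    by (intro connected_disjoint_filled)
  then show ?thesis
    using compl by blast
qed

section \<open>Loops around large discs and the four conclusions\<close>

theorem theorem4:
  fixes f :: "complex \<Rightarrow> complex" and c :: complex and \<rho> :: real and D :: "complex set"
    and \<gamma> :: "nat \<Rightarrow> real \<Rightarrow> complex"
  assumes "transcendental_entire f"
    and "D = ball c \<rho>" and "D \<inter> Julia_set f \<noteq> {}"
    and "\<And>n. n \<ge> 1 \<Longrightarrow> simple_path (\<gamma> n) \<and> pathfinish (\<gamma> n) = pathstart (\<gamma> n)"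
    and "\<And>n. n \<ge> 1 \<Longrightarrow> surrounds (path_image (\<gamma> n)) ((f ^^ n) ` D)"
    and "\<And>n. n \<ge> 1 \<Longrightarrow>
           surrounds (f ` path_image (\<gamma> n)) (inside (path_image (\<gamma> (Suc n))))"
  shows "(\<exists>U. open U \<and> connected U \<and> U \<noteq> {} \<and> bounded U \<and>
              frontier U \<subseteq> B_disc f D \<and> U \<inter> Julia_set f \<noteq> {}) \<and>
         connected (B_disc f D) \<and>
         (\<forall>c' \<rho>'. ball c' \<rho>' \<inter> Julia_set f \<noteq> {} \<longrightarrow> connected (B_set f (ball c' \<rho>'))) \<and>
         connected (escaping_set f)"
proof -
  have hol: "f holomorphic_on UNIV"
    using assms(1) by (simp add: transcendental_entire_def)
  have "\<not> f constant_on UNIV"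
  proof
    assume "f constant_on UNIV"
    then obtain a where "f = poly [:a:]"
      by (auto simp: constant_on_def fun_eq_iff)
    then show False
      using assms(1) by (auto simp: transcendental_entire_def)
  qed
  then interpret nonconstant_entire f
    using hol by unfold_locales
  define G where "G n = inside (path_image (\<gamma> n))" for n
  note Jordan = Jordan_inside_outside[of "\<gamma> n" for n]
  have D: "open D" "connected D" "D \<noteq> {}" "bounded D"
    using assms(2,3) by (auto simp del: ball_eq_empty)
  have G: "open (G n)" "bounded (G n)" "filled ((f ^^ n) ` D) \<subseteq> G n" if "n \<ge> 1" for n
    using Jordan[of n] assms(4)[OF that] filled_subset_inside_Jordan[of "\<gamma> n"] assms(5)[OF that]
    unfolding G_def by blast+
  \<comment> \<open>The frontier of \<open>G n\<close> is mapped into a set that surrounds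
    \<open>G (Suc n)\<close> and is therefore disjoint from it.\<close>
  have frG: "f z \<notin> G (Suc n)" if n: "n \<ge> 1" "z \<in> frontier (G n)" for n z
  proof -
    have "z \<in> path_image (\<gamma> n)"
      using n Jordan[of n] assms(4)[OF n(1)] unfolding G_def by blast
    moreover obtain C where "C \<in> components (- f ` path_image (\<gamma> n))" "G (Suc n) \<subseteq> C"
      using assms(6)[OF n(1)] by (auto simp: surrounds_def G_def)
    ultimately show ?thesis
      using in_components_subset by blast
  qed
  have large: "\<forall>\<^sub>F n in sequentially. ball 0 R \<subseteq> filled ((f ^^ n) ` D)" for R
    using eventually_ball_subset_filled_iterate assms(2,3) by blast
  obtain M where M: "D \<subseteq> ball 0 M"
    using bounded_subset_ballD[OF D(4)] by blast
  have "\<forall>N. \<exists>U. N \<ge> 1 \<longrightarrow> open U \<and> connected U \<and> bounded U \<and> (f ^^ N) ` D \<subseteq> U \<and>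
      (\<forall>z\<in>frontier U. \<forall>k. (f ^^ k) z \<notin> filled ((f ^^ (k + N)) ` D))"
  proof
    fix N
    show "\<exists>U. N \<ge> 1 \<longrightarrow> open U \<and> connected U \<and> bounded U \<and> (f ^^ N) ` D \<subseteq> U \<and>
      (\<forall>z\<in>frontier U. \<forall>k. (f ^^ k) z \<notin> filled ((f ^^ (k + N)) ` D))"
    proof (cases "N \<ge> 1")
      case True
      show ?thesis
        by (rule surrounding_domain[OF D(1-3) G frG True]) blast+
    qed auto
  qed
  from choice[OF this] obtain U where U0: "\<forall>N. N \<ge> 1 \<longrightarrow> open (U N) \<and> connected (U N) \<and>
      bounded (U N) \<and> (f ^^ N) ` D \<subseteq> U N \<and>
      (\<forall>z\<in>frontier (U N). \<forall>k. (f ^^ k) z \<notin> filled ((f ^^ (k + N)) ` D))" ..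
  have U: "open (U N)" "connected (U N)" "bounded (U N)" "(f ^^ N) ` D \<subseteq> U N"
      "\<And>z k. z \<in> frontier (U N) \<Longrightarrow> (f ^^ k) z \<notin> filled ((f ^^ (k + N)) ` D)" if "N \<ge> 1" for N
    using U0[rule_format, OF that] by blast+
  \<comment> \<open>For large \<open>N\<close> the filled image of \<open>D\<close> under
    \<open>f ^^ (N + L)\<close> contains \<open>D\<close>. Hence the filled image under
    \<open>f ^^ n\<close> lies in the one under \<open>f ^^ (n + (N + L))\<close>, which
    \<open>(f ^^ (n + L)) z\<close> avoids for \<open>z\<close> in
    \<open>frontier (U N)\<close>.\<close>
  have avoid: "\<forall>\<^sub>F N in sequentially. N \<ge> 1 \<and> frontier (U N) \<subseteq> avoiding D L" for L
  proof -
    have "\<forall>\<^sub>F N in sequentially. ball 0 M \<subseteq> filled ((f ^^ (N + L)) ` D)"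
      by (subst eventually_sequentially_seg) (rule large)
    then show ?thesis
      using eventually_ge_at_top[of 1]
    proof eventually_elim
      case (elim N)
      have *: "filled ((f ^^ n) ` D) \<subseteq> filled ((f ^^ (n + (N + L))) ` D)" for n
        unfolding iterate_image_add[of n] using M elim(1) D(1)
        by (intro filled_iterate_mono open_iterate_image) auto
      have "(f ^^ (n + L)) z \<notin> filled ((f ^^ n) ` D)" if z: "z \<in> frontier (U N)" for n z
      proof -
        have "n + L + N = n + (N + L)"
          by simp
        then show ?thesis
          using U(5)[OF elim(2) z, of "n + L"] *[of n] by (metis subsetD)
      qed
      then have "frontier (U N) \<subseteq> avoiding D L"
        by (auto simp: avoiding_def)
      then show ?case
        using elim(2) by blast
    qed
  qed
  have fill: "open (filled (U N))" "bounded (filled (U N))" "connected (frontier (filled (U N)))"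
      "frontier (filled (U N)) \<subseteq> frontier (U N)" "filled ((f ^^ N) ` D) \<subseteq> filled (U N)" if "N \<ge> 1" for N
    using open_filled[OF U(1)] bounded_filled[OF U(3)] connected_frontier_filled[OF U(2,3)]
      frontier_filled_subset[OF U(1)] filled_mono[OF U(4)] that by simp_all
  \<comment> \<open>Filling \<open>U N\<close> makes its frontier connected and, for large
    \<open>N\<close>, makes it contain any given disc.\<close>
  have loops: "\<exists>\<Omega>. open \<Omega> \<and> bounded \<Omega> \<and> connected (frontier \<Omega>) \<and>
      frontier \<Omega> \<subseteq> avoiding D L \<and> ball 0 R \<subseteq> \<Omega>" for R L
  proof -
    obtain N where "N \<ge> 1" "frontier (U N) \<subseteq> avoiding D L" "ball 0 R \<subseteq> filled ((f ^^ N) ` D)"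
      using eventually_happens'[OF sequentially_bot eventually_conj[OF avoid large]] by metis
    then show ?thesis
      using fill[of N] by (intro exI[of _ "filled (U N)"]) blast
  qed
  have conn: "connected (avoiding D L)" for L
    using D(1) loops by (rule connected_avoiding)
  have meet: "avoiding D 1 \<inter> avoiding D L \<noteq> {}" for L
  proof -
    obtain N where N: "N \<ge> 1" "frontier (U N) \<subseteq> avoiding D 1" "frontier (U N) \<subseteq> avoiding D L"
      using eventually_happens'[OF sequentially_bot eventually_conj[OF avoid avoid]] by metis
    have "U N \<noteq> {}" "U N \<noteq> UNIV"
      using U(3,4)[OF N(1)] D(3) not_bounded_UNIV by auto
    then have "frontier (U N) \<noteq> {}"
      by (simp add: frontier_eq_empty)
    then show ?thesis
      using N by blast
  qed
  have B_connected: "connected (B_set f D)"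
  proof -
    \<comment> \<open>Adding \<open>avoiding D 1\<close> to each piece gives connected sets with a
      common point.\<close>
    have "B_set f D = (\<Union>L\<in>{1..}. avoiding D 1 \<union> avoiding D L)"
      unfolding B_set_eq by auto
    also have "connected \<dots>"
    proof (rule connected_Union)
      show "connected S" if "S \<in> (\<lambda>L. avoiding D 1 \<union> avoiding D L) ` {1..}" for S
        using that conn meet by (auto intro: connected_Un)
      show "\<Inter> ((\<lambda>L. avoiding D 1 \<union> avoiding D L) ` {1..}) \<noteq> {}"
        using meet[of 1] by blast
    qed
    finally show ?thesis .
  qed
  have B_sub: "avoiding D 1 \<subseteq> B_set f D"
    unfolding B_set_eq by blast
  have "connected (escaping_set f)"
  proof (rule connected_escaping_set_via_loops[OF B_connected])
    show "B_set f D \<noteq> {}"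
      using B_sub meet[of 1] by blast
    show "B_set f D \<subseteq> escaping_set f"
      using B_set_subset_escaping_set assms(2,3) by blast
    show "\<exists>\<Omega>. open \<Omega> \<and> bounded \<Omega> \<and> frontier \<Omega> \<subseteq> B_set f D \<and> ball 0 R \<subseteq> \<Omega>" for R
      using loops[of 1 R] B_sub by blast
  qed (rule B_set_backward)
  moreover have "connected (B_set f (ball c' \<rho>'))" if "ball c' \<rho>' \<inter> Julia_set f \<noteq> {}" for c' \<rho>'
  proof -
    have "B_set f (ball c' \<rho>') = B_set f D"
      using B_set_subset[OF that] B_set_subset[of c \<rho>] assms(2,3) by blast
    then show ?thesis
      using B_connected by simp
  qed
  moreover have "\<exists>U. open U \<and> connected U \<and> U \<noteq> {} \<and> bounded U \<and>
      frontier U \<subseteq> B_disc f D \<and> U \<inter> Julia_set f \<noteq> {}"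
  proof -
    obtain N where N: "N \<ge> 1" "frontier (U N) \<subseteq> B_disc f D"
      using eventually_happens'[OF sequentially_bot avoid] unfolding B_disc_eq by blast
    obtain z where "z \<in> D" "z \<in> Julia_set f"
      using assms(3) by blast
    then have "(f ^^ N) z \<in> U N \<inter> Julia_set f"
      using U(4)[OF N(1)] Julia_set_funpow[OF hol] by blast
    then show ?thesis
      using U(1-3)[OF N(1)] N(2) by blast
  qed
  ultimately show ?thesis
    using conn[of 0] unfolding B_disc_eq by blast
qed

end
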